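(* Let $d\ge1$ and let $\lambda=\{\lambda_{k,d}\}_{0\le k\le d}$ be a sequence of positive numbers satisfying $$\log\frac{\lambda_{k,d}^2}{\lambda_{k-1,d}\lambda_{k+1,d}}>2\Delta_d:=\frac{d^2}{4}\log(36d)+(d+1)\log d+\log 4,\qquad 1\le k\le d-1.$$ Then, for any real polynomial $P$ of degree $d$, the number of positive (respectively negative) essential tropical roots of $tr_P^\lambda$ is greater than or equal to the number of positive (respectively negative) roots of $P$. In particular, $\lambda$ is a degree $d$ real-to-tropical root preserver.
   Context: Tropical indices. For a real polynomial $Q(x)=\sum_{k=0}^d b_kx^k$ of degree $d$, an integer $k\in\{0,\dots,d\}$ is a tropical index of $Q$ if there is a real $x_k>0$ with $|b_k|x_k^k\ge\max_{i\ne k}|b_i|x_k^i$. Essential tropical roots. For a real polynomial $P(x)=\sum_{k=0}^d a_kx^k$ of degree $d$, its $\lambda$-tropicalization is $tr_P^\lambda(\xi)=\max_{0\le k\le d}(k\xi+\ln|a_k|+\ln\lambda_{k,d})$, $\xi\in\mathbb{R}$ (terms with $a_k=0$ are ignored). Its tropical indices $k_0<k_1<\dots<k_m$ are the tropical indices of $\sum_k\lambda_{k,d}a_kx^k$. The number of positive (resp. negative) essential tropical roots of $tr_P^\lambda$ is the number of sign alternations in $\{\mathrm{sgn}(a_{k_i})\}_{0\le i\le m}$ (resp. $\{\mathrm{sgn}((-1)^{k_i}a_{k_i})\}_{0\le i\le m}$). The number of essential tropical roots is the sum of these two numbers. A sequence $\{\lambda_{k,d}\}_{0\le k\le d}$ of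 positive numbers is a degree $d$ real-to-tropical root preserver if for every real polynomial $P$ of degree $d$ the number of essential tropical roots of $tr_P^\lambda$ is at least the number of non-zero real roots of $P$. Real roots are counted with multiplicity. *)

theory Defs
  imports Complex_Main "HOL-Computational_Algebra.Polynomial"
begin

definition tropical_index :: "real poly \<Rightarrow> nat \<Rightarrow> bool" where
  "tropical_index Q k \<longleftrightarrow> k \<le> degree Q \<and>
     (\<exists>x>0. \<forall>i\<le>degree Q. i \<noteq> k \<longrightarrow> \<bar>coeff Q i\<bar> * x ^ i \<le> \<bar>coeff Q k\<bar> * x ^ k)"

definition tropicalization :: "(nat \<Rightarrow> real) \<Rightarrow> real poly \<Rightarrow> real \<Rightarrow> real" where
  "tropicalization lam P \<xi> =
     Max ((\<lambda>k. real k * \<xi> + ln \<bar>coeff P k\<bar> + ln (lam k)) ` {k. k \<le> degree P \<and> coeff P k \<noteq> 0})"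

definition weighted_poly :: "(nat \<Rightarrow> real) \<Rightarrow> real poly \<Rightarrow> real poly" where
  "weighted_poly lam P = (\<Sum>k\<le>degree P. monom (lam k * coeff P k) k)"

text \<open>The tropical indices of the tropicalization of \<open>P\<close> in increasing order; the lemma
  \<open>tropical_index_weighted_iff\<close> below relates them to the function \<^const>\<open>tropicalization\<close>.\<close>

definition tropical_indices :: "(nat \<Rightarrow> real) \<Rightarrow> real poly \<Rightarrow> nat list" where
  "tropical_indices lam P = sorted_list_of_set {k. tropical_index (weighted_poly lam P) k}"

definition sign_alternations :: "real list \<Rightarrow> nat" where
  "sign_alternations xs = card {i. Suc i < length xs \<and> xs ! i * xs ! Suc i < 0}"

definition pos_essential_tropical_roots :: "(nat \<Rightarrow> real) \<Rightarrow> real poly \<Rightarrow> nat" where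
  "pos_essential_tropical_roots lam P =
     sign_alternations (map (\<lambda>k. sgn (coeff P k)) (tropical_indices lam P))"

definition neg_essential_tropical_roots :: "(nat \<Rightarrow> real) \<Rightarrow> real poly \<Rightarrow> nat" where
  "neg_essential_tropical_roots lam P =
     sign_alternations (map (\<lambda>k. sgn ((-1) ^ k * coeff P k)) (tropical_indices lam P))"

definition essential_tropical_roots :: "(nat \<Rightarrow> real) \<Rightarrow> real poly \<Rightarrow> nat" where
  "essential_tropical_roots lam P =
     pos_essential_tropical_roots lam P + neg_essential_tropical_roots lam P"

text \<open>Roots are counted with multiplicity: \<^const>\<open>proots\<close> is the multiset of all roots.\<close>

definition pos_roots :: "real poly \<Rightarrow> nat" where
  "pos_roots P = size {#x \<in># proots P. x > 0#}"

definition neg_roots :: "real poly \<Rightarrow> nat" where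
  "neg_roots P = size {#x \<in># proots P. x < 0#}"

definition nonzero_roots :: "real poly \<Rightarrow> nat" where
  "nonzero_roots P = size {#x \<in># proots P. x \<noteq> 0#}"

text \<open>Only the values \<open>lam k\<close> with \<open>k \<le> d\<close> matter. The condition \<open>P \<noteq> 0\<close> is relevant only for
  \<open>d = 0\<close>, since the zero polynomial has \<^const>\<open>degree\<close> zero here.\<close>

definition real_to_tropical_root_preserver :: "nat \<Rightarrow> (nat \<Rightarrow> real) \<Rightarrow> bool" where
  "real_to_tropical_root_preserver d lam \<longleftrightarrow> (\<forall>k\<le>d. lam k > 0) \<and>
     (\<forall>P :: real poly. P \<noteq> 0 \<and> degree P = d \<longrightarrow>
        nonzero_roots P \<le> essential_tropical_roots lam P)"

definition Delta :: "nat \<Rightarrow> real" where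
  "Delta d = ((real d)\<^sup>2 / 4 * ln (36 * real d) + (real d + 1) * ln (real d) + ln 4) / 2"

lemma coeff_weighted_poly: "coeff (weighted_poly lam P) i = lam i * coeff P i"
  by (cases "i \<le> degree P") (auto simp: weighted_poly_def coeff_sum coeff_eq_0)

lemma degree_weighted_poly:
  assumes "\<forall>k\<le>degree P. lam k > 0"
  shows "degree (weighted_poly lam P) = degree P"
proof (cases "P = 0")
  case True
  then show ?thesis by (simp add: weighted_poly_def)
next
  case False
  have "lam (degree P) * coeff P (degree P) \<noteq> 0"
    using assms False by (auto dest: spec[of _ "degree P"])
  then show ?thesis
    by (intro antisym degree_le le_degree) (auto simp: coeff_weighted_poly coeff_eq_0)
qed

lemma tropical_index_weighted_iff:
  assumes "P \<noteq> 0" and pos: "\<forall>k\<le>degree P. lam k > 0"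
  shows "tropical_index (weighted_poly lam P) k \<longleftrightarrow> k \<le> degree P \<and> coeff P k \<noteq> 0 \<and>
    (\<exists>\<xi>. tropicalization lam P \<xi> = real k * \<xi> + ln \<bar>coeff P k\<bar> + ln (lam k))"
    (is "?L \<longleftrightarrow> ?R")
proof -
  define S where "S = {k. k \<le> degree P \<and> coeff P k \<noteq> 0}"
  define g where "g \<xi> k = real k * \<xi> + ln \<bar>coeff P k\<bar> + ln (lam k)" for \<xi> k
  have tr: "tropicalization lam P \<xi> = Max (g \<xi> ` S)" for \<xi>
    by (simp add: tropicalization_def g_def S_def)
  have fin: "finite S" by (simp add: S_def)
  have topS: "degree P \<in> S" using assms(1) by (simp add: S_def)
  have eg: "\<bar>lam i * coeff P i\<bar> * exp \<xi> ^ i = exp (g \<xi> i)" if "i \<in> S" for i \<xi>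
  proof -
    have "lam i > 0" "coeff P i \<noteq> 0" using that pos by (auto simp: S_def)
    then show ?thesis by (simp add: g_def exp_add abs_mult exp_of_nat_mult)
  qed
  have L: "?L \<longleftrightarrow> k \<le> degree P \<and> (\<exists>\<xi>. \<forall>i\<le>degree P. i \<noteq> k \<longrightarrow>
      \<bar>lam i * coeff P i\<bar> * exp \<xi> ^ i \<le> \<bar>lam k * coeff P k\<bar> * exp \<xi> ^ k)"
    unfolding tropical_index_def degree_weighted_poly[OF pos] coeff_weighted_poly
    by (metis exp_gt_zero exp_ln)
  have "(\<forall>i\<le>degree P. i \<noteq> k \<longrightarrow>
      \<bar>lam i * coeff P i\<bar> * exp \<xi> ^ i \<le> \<bar>lam k * coeff P k\<bar> * exp \<xi> ^ k)
      \<longleftrightarrow> k \<in> S \<and> Max (g \<xi> ` S) = g \<xi> k" (is "?A \<longleftrightarrow> ?B") if k: "k \<le> degree P" for \<xi>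
  proof
    assume A: ?A
    have kS: "k \<in> S"
    proof (rule ccontr)
      assume "k \<notin> S"
      with k have "coeff P k = 0" by (simp add: S_def)
      moreover from this have "degree P \<noteq> k" using assms(1) by auto
      ultimately have "exp (g \<xi> (degree P)) \<le> 0"
        using A[rule_format, of "degree P"] eg[OF topS, of \<xi>] by simp
      then show False by simp
    qed
    have "g \<xi> i \<le> g \<xi> k" if "i \<in> S" for i
      using A[rule_format, of i] eg[OF that, of \<xi>] eg[OF kS, of \<xi>] that
      by (cases "i = k") (auto simp: S_def)
    then show ?B using kS fin by (auto intro!: Max_eqI)
  next
    assume B: ?B
    show ?A
    proof (intro allI impI)
      fix i assume i: "i \<le> degree P" "i \<noteq> k"
      show "\<bar>lam i * coeff P i\<bar> * exp \<xi> ^ i \<le> \<bar>lam k * coeff P k\<bar> * exp \<xi> ^ k"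
      proof (cases "i \<in> S")
        case True
        then have "g \<xi> i \<le> g \<xi> k" using B fin by (metis Max_ge finite_imageI imageI)
        then show ?thesis using eg[OF True, of \<xi>] eg[of k \<xi>] B by simp
      next
        case False
        then show ?thesis using i by (simp add: S_def)
      qed
    qed
  qed
  then show ?thesis unfolding L tr by (auto simp: S_def g_def)
qed

end

theory Submission
  imports Defs
begin

text \<open>
  Let \<open>ks\<close> be the increasing list of tropical indices of \<open>P\<close>, and let the coefficients of \<open>P\<close>
  change sign between the neighbours \<open>ks ! i\<close> and \<open>ks ! Suc i\<close> exactly for \<open>i \<in> A\<close>, so that
  \<open>card A\<close> is the number of positive essential tropical roots. The idea is to apply to \<open>P\<close> one
  operator \<open>x d/dx - c i\<close> for every \<open>i \<in> A\<close>, where \<open>c i = ks ! i + 1/2\<close>. By Rolle's theorem for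
  \<open>x powr (- c) * P x\<close>, one such operator loses at most one positive root, with multiplicity
  (lemma \<open>pos_roots_le_Suc_pos_roots_euler_shift\<close>). Hence \<open>P\<close> has at most \<open>card A\<close> positive roots
  more than the resulting polynomial \<open>Q\<close>, and it remains to see that \<open>Q\<close> has none.

  The \<open>k\<close>-th coefficient is multiplied by the product of all \<open>k - c i\<close>, which changes sign exactly
  between the neighbours at which \<open>P\<close> has an alternation. So all coefficients of \<open>Q\<close> at tropical
  indices are non-zero and of the same sign \<open>\<sigma>\<close>. The other monomials are too small to matter: fix
  \<open>x > 0\<close> and let \<open>m\<close> maximize \<open>\<bar>coeff P k\<bar> * x ^ k\<close>. Since the weights are strongly log-concave,
  \<open>m\<close> is a tropical index, and so is every \<open>k\<close> whose monomial comes within the factor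
  \<open>exp (Delta d)\<close> of the maximum (lemma \<open>tropical_index_weighted_polyI\<close>). The multipliers are
  between \<open>(1/2) ^ d\<close> and \<open>d ^ d\<close> in absolute value, and \<open>exp (Delta d)\<close> is at least
  \<open>d * (2 * d) ^ d\<close> (lemma \<open>exp_Delta_ge\<close>), so the \<open>m\<close>-th monomial of \<open>Q\<close> outweighs all those of
  sign opposite to \<open>\<sigma>\<close>, and \<open>poly Q x \<noteq> 0\<close>.

  Negative roots are handled by substituting \<open>- x\<close> for \<open>x\<close>.
\<close>

section \<open>Rolle's theorem with multiplicities for shifted Euler operators\<close>

text \<open>The operator \<open>x d/dx - c\<close>, which multiplies the \<open>k\<close>-th coefficient by \<open>k - c\<close>.\<close>

definition euler_shift :: "real \<Rightarrow> real poly \<Rightarrow> real poly" where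
  "euler_shift c P = pCons 0 (pderiv P) - smult c P"

lemma coeff_euler_shift: "coeff (euler_shift c P) k = (real k - c) * coeff P k"
  by (cases k) (auto simp: euler_shift_def coeff_pderiv algebra_simps)

lemma poly_euler_shift: "poly (euler_shift c P) x = x * poly (pderiv P) x - c * poly P x"
  by (simp add: euler_shift_def)

lemma order_le_Suc_order_euler_shift:
  assumes "euler_shift c P \<noteq> 0"
  shows "order x P \<le> Suc (order x (euler_shift c P))"
proof (cases "order x P")
  case (Suc n)
  have P: "[:-x, 1:] ^ Suc n dvd P"
    using order_1[of x P] Suc by simp
  then obtain Q where Q: "P = [:-x, 1:] ^ Suc n * Q" ..
  have "[:-x, 1:] ^ n dvd pderiv P"
    unfolding Q lemma_order_pderiv1
    by (intro dvd_add dvd_smult dvd_mult dvd_mult2[OF le_imp_power_dvd]) auto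
  moreover have "euler_shift c P = [:0, 1:] * pderiv P - smult c P"
    by (simp add: euler_shift_def)
  moreover have "[:-x, 1:] ^ n dvd P"
    using P power_le_dvd[of "[:-x, 1:]" "Suc n" P n] by simp
  ultimately have "[:-x, 1:] ^ n dvd euler_shift c P"
    by (metis dvd_diff dvd_mult dvd_smult)
  then show ?thesis
    using assms Suc by (simp add: order_divides)
qed simp

lemma euler_shift_root_between:
  assumes "0 < a" "a < b" "poly P a = 0" "poly P b = 0"
  shows "\<exists>z. a < z \<and> z < b \<and> poly (euler_shift c P) z = 0"
proof -
  \<comment> \<open>On the positive axis \<open>euler_shift c P\<close> is \<open>x powr (c + 1)\<close> times the derivative of \<open>f\<close>.\<close>
  define f where "f x = x powr (- c) * poly P x" for x
  define f' where "f' x = x powr (- c - 1) * poly (euler_shift c P) x" for x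
  have der: "(f has_real_derivative f' x) (at x)" if "0 < x" for x
  proof -
    have "x powr (- c) = x powr (- c - 1) * x"
      using that by (simp add: powr_diff)
    then show ?thesis
      unfolding f_def f'_def using that
      by (auto intro!: derivative_eq_intros simp: poly_euler_shift algebra_simps)
  qed
  have "\<exists>z. a < z \<and> z < b \<and> (*) (f' z) = (\<lambda>v. 0)"
  proof (rule Rolle_deriv[OF \<open>a < b\<close>])
    show "f a = f b" using assms by (simp add: f_def)
    have "isCont f x" if "x \<in> {a..b}" for x
      using that assms by (intro DERIV_isCont[OF der]) auto
    then show "continuous_on {a..b} f"
      by (intro continuous_at_imp_continuous_on) auto
    show "(f has_derivative (*) (f' x)) (at x)" if "a < x" "x < b" for x
      using der[of x] that assms by (simp add: has_field_derivative_def)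
  qed
  then obtain z where z: "a < z" "z < b" "f' z * 1 = 0"
    by metis
  then show ?thesis
    using assms by (intro exI[of _ z]) (auto simp: f'_def)
qed

lemma pos_roots_eq_sum_order:
  assumes "P \<noteq> 0"
  shows "pos_roots P = (\<Sum>x | 0 < x \<and> poly P x = 0. order x P)"
proof -
  have "{x \<in> set_mset (proots P). 0 < x} = {x. 0 < x \<and> poly P x = 0}"
    using assms by auto
  then show ?thesis
    using assms by (simp add: pos_roots_def size_multiset_overloaded_eq)
qed

text \<open>A root of \<open>P\<close> loses at most one order, and between any two consecutive positive roots of \<open>P\<close>
  there is a root of the image that is not a root of \<open>P\<close>.\<close>

lemma pos_roots_le_Suc_pos_roots_euler_shift:
  assumes "euler_shift c P \<noteq> 0"
  shows "pos_roots P \<le> Suc (pos_roots (euler_shift c P))"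
proof -
  define R where "R = euler_shift c P"
  define S where "S = {x. 0 < x \<and> poly P x = 0}"
  define U where "U = {x. 0 < x \<and> poly R x = 0}"
  have P: "P \<noteq> 0" and R: "R \<noteq> 0"
    using assms by (auto simp: R_def euler_shift_def)
  have finS: "finite S" and finU: "finite U"
    using poly_roots_finite[OF P] poly_roots_finite[OF R] by (auto simp: S_def U_def)
  show ?thesis
  proof (cases "S = {}")
    case True
    then show ?thesis
      by (simp add: pos_roots_eq_sum_order[OF P] S_def[symmetric])
  next
    case False
    \<comment> \<open>The next larger positive root of \<open>P\<close>.\<close>
    define nxt where "nxt a = Min {y \<in> S. a < y}" for a
    have nxt: "nxt a \<in> S" "a < nxt a" "\<And>y. y \<in> S \<Longrightarrow> a < y \<Longrightarrow> nxt a \<le> y"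
      if "a \<in> S - {Max S}" for a
    proof -
      have "Max S \<in> {y \<in> S. a < y}"
        using that finS False by (auto simp: less_le)
      then have "nxt a \<in> {y \<in> S. a < y}"
        unfolding nxt_def using finS by (intro Min_in) auto
      then show "nxt a \<in> S" "a < nxt a" by auto
      show "nxt a \<le> y" if "y \<in> S" "a < y" for y
        unfolding nxt_def using finS that by (intro Min_le) auto
    qed
    have "\<exists>z. a < z \<and> z < nxt a \<and> poly R z = 0" if "a \<in> S - {Max S}" for a
      unfolding R_def using nxt[OF that] that
      by (intro euler_shift_root_between) (auto simp: S_def)
    then obtain z where z: "\<And>a. a \<in> S - {Max S} \<Longrightarrow> a < z a \<and> z a < nxt a \<and> poly R (z a) = 0"
      by metis
    have "z a < z b" if "a \<in> S - {Max S}" "b \<in> S - {Max S}" "a < b" for a b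
      using z[OF that(1)] z[OF that(2)] nxt(3)[OF that(1), of b] that by auto
    then have inj: "inj_on z (S - {Max S})"
      by (intro inj_onI) (metis less_irrefl linorder_neqE)
    have zU: "z ` (S - {Max S}) \<subseteq> U - S"
    proof (rule image_subsetI)
      fix a assume "a \<in> S - {Max S}"
      then have a: "a \<in> S" "a \<noteq> Max S" by auto
      have "z a \<notin> S"
        using z[of a] nxt(3)[of a "z a"] a by auto
      then show "z a \<in> U - S"
        using z[of a] a by (auto simp: U_def S_def)
    qed
    have "card S - 1 = card (z ` (S - {Max S}))"
      using finS False by (simp add: card_image[OF inj])
    also have "\<dots> \<le> card (U - S)"
      using zU finU by (intro card_mono) auto
    also have "\<dots> = (\<Sum>x\<in>U - S. 1)" by simp
    also have "\<dots> \<le> (\<Sum>x\<in>U - S. order x R)"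
      using R order_root[of R] by (intro sum_mono) (auto simp: U_def Suc_le_eq)
    finally have between: "card S \<le> Suc (\<Sum>x\<in>U - S. order x R)"
      by simp
    have "pos_roots P \<le> (\<Sum>x\<in>S. Suc (order x R))"
      unfolding pos_roots_eq_sum_order[OF P] S_def[symmetric] R_def
      using assms by (intro sum_mono order_le_Suc_order_euler_shift) auto
    also have "\<dots> = (\<Sum>x\<in>S. order x R) + card S"
      by (subst sum_Suc) simp
    also have "(\<Sum>x\<in>S. order x R) = (\<Sum>x\<in>S \<inter> U. order x R)"
      using finS by (intro sum.mono_neutral_right) (auto simp: S_def U_def order_0I)
    also have "(\<Sum>x\<in>S \<inter> U. order x R) + card S
        \<le> Suc ((\<Sum>x\<in>U \<inter> S. order x R) + (\<Sum>x\<in>U - S. order x R))"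
      using between by (simp add: Int_commute)
    also have "(\<Sum>x\<in>U \<inter> S. order x R) + (\<Sum>x\<in>U - S. order x R) = pos_roots R"
      unfolding pos_roots_eq_sum_order[OF R] U_def[symmetric]
      by (rule sum.Int_Diff[OF finU, symmetric])
    finally show ?thesis by (simp add: R_def)
  qed
qed

lemma pos_roots_le_iterated_euler_shift:
  fixes c :: "nat \<Rightarrow> real"
  assumes "finite A" "P \<noteq> 0" "\<And>i k. i \<in> A \<Longrightarrow> real k \<noteq> c i"
  shows "\<exists>Q. (\<forall>k. coeff Q k = (\<Prod>i\<in>A. real k - c i) * coeff P k) \<and>
             pos_roots P \<le> pos_roots Q + card A"
  using assms
proof (induction A rule: finite_induct)
  case empty
  then show ?case by auto
next
  case (insert j A)
  then obtain Q where Q: "\<And>k. coeff Q k = (\<Prod>i\<in>A. real k - c i) * coeff P k"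
    "pos_roots P \<le> pos_roots Q + card A"
    by auto
  have "coeff (euler_shift (c j) Q) (degree P) \<noteq> 0"
    using insert.prems insert.hyps by (auto simp: coeff_euler_shift Q)
  then have "euler_shift (c j) Q \<noteq> 0" by auto
  from pos_roots_le_Suc_pos_roots_euler_shift[OF this] Q insert.hyps show ?case
    by (intro exI[of _ "euler_shift (c j) Q"]) (auto simp: coeff_euler_shift)
qed

section \<open>Strongly log-concave weights\<close>

text \<open>A concave sequence with second differences at most \<open>- 2 * \<delta>\<close> has at every \<open>k\<close> a supporting
  line that exceeds all other values by at least \<open>\<delta>\<close>.\<close>

lemma strongly_concave_bound:
  fixes L :: "nat \<Rightarrow> real" and \<delta> :: real
  assumes "0 \<le> \<delta>" and "k \<le> d"
    and conc: "\<And>j. 1 \<le> j \<Longrightarrow> Suc j \<le> d \<Longrightarrow> L (j - 1) + L (Suc j) + 2 * \<delta> \<le> 2 * L j"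
  shows "\<exists>s. \<forall>i\<le>d. i \<noteq> k \<longrightarrow> L i - real i * s + \<delta> \<le> L k - real k * s"
proof -
  \<comment> \<open>A slope at distance at least \<open>\<delta>\<close> from the slopes of \<open>L\<close> on both sides of \<open>k\<close>.\<close>
  define s where "s = (if k = 0 then L 1 - L 0 + \<delta> else if k = d then L k - L (k - 1) - \<delta>
                        else (L (Suc k) - L (k - 1)) / 2)"
  have left: "s + \<delta> \<le> L k - L (k - 1)" if "0 < k"
    using that conc[of k] assms by (auto simp: s_def field_simps)
  have right: "L (Suc k) - L k \<le> s - \<delta>" if "k < d"
    using that conc[of k] assms by (auto simp: s_def field_simps)
  have up: "k + Suc n \<le> d \<Longrightarrow> L (k + Suc n) - L (k + n) \<le> s - \<delta> \<and>
      L (k + Suc n) - real (Suc n) * s + \<delta> \<le> L k" for n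
  proof (induction n)
    case 0
    then show ?case using right by auto
  next
    case (Suc n)
    then show ?case using conc[of "k + Suc n"] \<open>0 \<le> \<delta>\<close> by (auto simp: algebra_simps)
  qed
  have down: "Suc n \<le> k \<Longrightarrow> s + \<delta> \<le> L (k - n) - L (k - Suc n) \<and>
      L (k - Suc n) + real (Suc n) * s + \<delta> \<le> L k" for n
  proof (induction n)
    case 0
    then show ?case using left by auto
  next
    case (Suc n)
    then have "L (k - Suc n - 1) + L (Suc (k - Suc n)) + 2 * \<delta> \<le> 2 * L (k - Suc n)"
      using assms by (intro conc) auto
    moreover have "k - Suc n - 1 = k - Suc (Suc n)" "Suc (k - Suc n) = k - n"
      using Suc.prems by auto
    ultimately show ?case using Suc \<open>0 \<le> \<delta>\<close> by (auto simp: algebra_simps)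
  qed
  have "L i - real i * s + \<delta> \<le> L k - real k * s" if "i \<le> d" "i \<noteq> k" for i
  proof (cases "k < i")
    case True
    then obtain n where "i = k + Suc n" using less_iff_Suc_add by auto
    then show ?thesis using up[of n] that by (simp add: algebra_simps)
  next
    case False
    with that obtain n where "k = i + Suc n"
      using less_iff_Suc_add[of i k] by auto
    then show ?thesis using down[of n] by (simp add: algebra_simps)
  qed
  then show ?thesis by blast
qed

text \<open>The quantitative heart of the argument: with strongly log-concave weights, an index is
  tropical as soon as its unweighted monomial is, at one point \<open>x\<close>,
  at least \<open>exp (- \<delta>)\<close> times every other one. With \<open>s\<close> the slope of a supporting line of
  \<open>\<lambda>i. ln (lam i)\<close> at \<open>k\<close>, the weighted monomial dominates at the point \<open>x * exp (- s)\<close>.\<close>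

lemma tropical_index_weighted_polyI:
  fixes lam :: "nat \<Rightarrow> real" and \<delta> :: real
  assumes deg: "degree P = d" and "0 \<le> \<delta>"
    and pos: "\<forall>k\<le>d. lam k > 0"
    and conc: "\<forall>k\<in>{1..d - 1}. 2 * \<delta> < ln ((lam k)\<^sup>2 / (lam (k - 1) * lam (k + 1)))"
    and "k \<le> d" "0 < x"
    and dom: "\<And>i. i \<le> d \<Longrightarrow> i \<noteq> k \<Longrightarrow> \<bar>coeff P i\<bar> * x ^ i \<le> exp \<delta> * (\<bar>coeff P k\<bar> * x ^ k)"
  shows "tropical_index (weighted_poly lam P) k"
proof -
  have "\<exists>s. \<forall>i\<le>d. i \<noteq> k \<longrightarrow> ln (lam i) - real i * s + \<delta> \<le> ln (lam k) - real k * s"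
  proof (rule strongly_concave_bound[OF \<open>0 \<le> \<delta>\<close> \<open>k \<le> d\<close>])
    fix j assume j: "1 \<le> j" "Suc j \<le> d"
    then have "lam j > 0" "lam (j - 1) > 0" "lam (j + 1) > 0" using pos by auto
    then have "ln ((lam j)\<^sup>2 / (lam (j - 1) * lam (j + 1)))
        = 2 * ln (lam j) - (ln (lam (j - 1)) + ln (lam (j + 1)))"
      by (simp add: ln_div ln_mult ln_realpow)
    moreover have "j \<in> {1..d - 1}" using j by auto
    ultimately show "ln (lam (j - 1)) + ln (lam (Suc j)) + 2 * \<delta> \<le> 2 * ln (lam j)"
      using conc by force
  qed
  then obtain s where s: "\<And>i. i \<le> d \<Longrightarrow> i \<noteq> k \<Longrightarrow>
      ln (lam i) - real i * s + \<delta> \<le> ln (lam k) - real k * s" by blast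
  define y where "y = x * exp (- s)"
  have ypow: "y ^ i = x ^ i * exp (- (real i * s))" for i
    by (simp add: y_def power_mult_distrib exp_of_nat_mult[symmetric])
  have "\<bar>coeff (weighted_poly lam P) i\<bar> * y ^ i \<le> \<bar>coeff (weighted_poly lam P) k\<bar> * y ^ k"
    if i: "i \<le> d" "i \<noteq> k" for i
  proof -
    have e: "lam j * exp (- (real j * s)) = exp (ln (lam j) - real j * s)" if "j \<le> d" for j
      using that pos by (simp add: exp_diff exp_minus divide_inverse)
    have "\<bar>coeff (weighted_poly lam P) i\<bar> * y ^ i
        = (\<bar>coeff P i\<bar> * x ^ i) * (lam i * exp (- (real i * s)))"
      using pos[rule_format, OF i(1)] by (simp add: coeff_weighted_poly ypow abs_mult)
    also have "\<dots> \<le> (exp \<delta> * (\<bar>coeff P k\<bar> * x ^ k)) * exp (ln (lam i) - real i * s)"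
      unfolding e[OF i(1)] using dom[OF i] by (intro mult_right_mono) auto
    also have "\<dots> = (\<bar>coeff P k\<bar> * x ^ k) * exp (ln (lam i) - real i * s + \<delta>)"
      by (simp add: exp_add)
    also have "\<dots> \<le> (\<bar>coeff P k\<bar> * x ^ k) * exp (ln (lam k) - real k * s)"
      using s[OF i] \<open>0 < x\<close> by (intro mult_left_mono) auto
    also have "\<dots> = \<bar>coeff (weighted_poly lam P) k\<bar> * y ^ k"
      unfolding e[OF \<open>k \<le> d\<close>, symmetric] using pos[rule_format, OF \<open>k \<le> d\<close>]
      by (simp add: coeff_weighted_poly ypow abs_mult)
    finally show ?thesis .
  qed
  moreover have "0 < y" using \<open>0 < x\<close> by (simp add: y_def)
  moreover have "degree (weighted_poly lam P) = d"
    using degree_weighted_poly[of P lam] pos deg by simp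
  ultimately show ?thesis
    using \<open>k \<le> d\<close> unfolding tropical_index_def by blast
qed

lemma exp_Delta_ge:
  assumes "d \<ge> 1"
  shows "real d * (2 * real d) ^ d \<le> exp (Delta d)"
proof -
  have d: "real d \<ge> 1" using assms by simp
  have three: "real d \<le> 3 ^ (d - 1)"
  proof -
    have "n + 1 \<le> 3 ^ n" for n :: nat
      by (induction n) auto
    from this[of "d - 1"] have "d \<le> 3 ^ (d - 1)" using assms by simp
    then show ?thesis by (metis of_nat_le_iff of_nat_numeral of_nat_power)
  qed
  have ln36: "ln (36 * real d) = 2 * ln 2 + 2 * ln 3 + ln (real d)"
  proof -
    have "36 * real d = 2 ^ 2 * 3 ^ 2 * real d" by simp
    then show ?thesis using d by (simp only: ln_mult ln_realpow) (simp add: ln_mult ln_realpow)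
  qed
  have ln4: "ln (4::real) = 2 * ln 2"
    using ln_realpow[of 2 2] by simp
  \<comment> \<open>The quadratic term is used only through \<open>d\<^sup>2 / 4 \<ge> d - 1\<close>.\<close>
  have "0 \<le> (real d - 2)\<^sup>2 / 4 * ln (36 * real d)"
    using d by (intro mult_nonneg_nonneg) auto
  then have "(real d - 1) * ln (36 * real d) \<le> (real d)\<^sup>2 / 4 * ln (36 * real d)"
    by (simp add: power2_eq_square algebra_simps)
  then have "(real d - 1) * ln 3 + real d * ln 2 + real d * ln (real d) \<le> Delta d"
    unfolding Delta_def ln36 ln4 by (simp add: field_simps)
  moreover have "ln (real d) \<le> (real d - 1) * ln 3"
  proof -
    have "ln (real d) \<le> ln (3 ^ (d - 1))"
      using three d by (subst ln_le_cancel_iff) auto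
    then show ?thesis using assms by (simp add: ln_realpow of_nat_diff)
  qed
  moreover have "ln (real d * (2 * real d) ^ d) = ln (real d) + real d * (ln 2 + ln (real d))"
    using d by (simp add: ln_mult ln_realpow distrib_left)
  ultimately have "ln (real d * (2 * real d) ^ d) \<le> Delta d"
    by (simp add: algebra_simps)
  then show ?thesis
    using d by (metis exp_le_cancel_iff exp_ln less_le_trans mult_pos_pos zero_less_numeral zero_less_one zero_less_power)
qed

lemma Delta_nonneg: "d \<ge> 1 \<Longrightarrow> 0 \<le> Delta d"
  unfolding Delta_def by (auto intro!: add_nonneg_nonneg mult_nonneg_nonneg)

section \<open>Positive roots\<close>

lemma pos_roots_le_pos_essential_tropical_roots:
  fixes lam :: "nat \<Rightarrow> real"
  assumes d: "d \<ge> 1" and deg: "degree P = d"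
    and pos: "\<forall>k\<le>d. lam k > 0"
    and conc: "\<forall>k\<in>{1..d - 1}. ln ((lam k)\<^sup>2 / (lam (k - 1) * lam (k + 1))) > 2 * Delta d"
  shows "pos_roots P \<le> pos_essential_tropical_roots lam P"
proof -
  have P: "P \<noteq> 0" using d deg by auto
  define T where "T = {k. tropical_index (weighted_poly lam P) k}"
  define ks where "ks = tropical_indices lam P"
  define A where "A = {i. Suc i < length ks \<and> coeff P (ks ! i) * coeff P (ks ! Suc i) < 0}"
  have T: "k \<le> d" "coeff P k \<noteq> 0" if "k \<in> T" for k
    using that tropical_index_weighted_iff[OF P, of lam k] pos deg by (auto simp: T_def)
  have finT: "finite T" by (rule finite_subset[of _ "{..d}"]) (auto dest: T)
  have set_ks: "set ks = T" and sorted_ks: "sorted_wrt (<) ks"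
    using finT by (auto simp: ks_def tropical_indices_def T_def[symmetric])
  have "length ks = card T"
    using finT by (simp add: ks_def tropical_indices_def T_def[symmetric])
  also have "\<dots> \<le> card {..d}"
    by (intro card_mono) (auto dest: T)
  finally have "A \<subseteq> {..<d}" by (auto simp: A_def)
  then have finA: "finite A" and cardA: "card A \<le> d"
    using card_mono[of "{..<d}" A] by (auto intro: finite_subset)
  have mono_ks: "ks ! i < ks ! j" if "i < j" "j < length ks" for i j
    using sorted_ks that by (simp add: sorted_wrt_iff_nth_less)
  have ks_le: "ks ! i \<le> d" if "i < length ks" for i
    using T(1) set_ks nth_mem[OF that] by auto
  have essential: "pos_essential_tropical_roots lam P = card A"
  proof -
    have "sgn a * sgn b < 0 \<longleftrightarrow> a * b < 0" for a b :: real
      by (metis sgn_less sgn_mult)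
    then show ?thesis
      unfolding pos_essential_tropical_roots_def sign_alternations_def ks_def[symmetric] A_def
      by (intro arg_cong[where f = card] Collect_cong) auto
  qed

  \<comment> \<open>Half-integers: never an index, and at distance at least \<open>1/2\<close> from every index.\<close>
  define c where "c i = real (ks ! i) + 1/2" for i
  define w where "w k = (\<Prod>i\<in>A. real k - c i)" for k
  have c_half: "1/2 \<le> \<bar>real k - c i\<bar>" for k i
  proof -
    have "k + 1 \<le> ks ! i \<or> k = ks ! i \<or> ks ! i + 1 \<le> k"
      by linarith
    then have "real k + 1 \<le> real (ks ! i) \<or> real k = real (ks ! i) \<or> real (ks ! i) + 1 \<le> real k"
      by auto
    then show ?thesis by (auto simp: c_def)
  qed
  then have c_not_nat: "real k \<noteq> c i" for k i
    by (metis abs_zero diff_self half_gt_zero_iff linorder_not_le zero_less_one)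
  have w_lower: "(1/2) ^ d \<le> \<bar>w k\<bar>" for k
  proof -
    have "(1/2::real) ^ d \<le> (1/2) ^ card A"
      using cardA by (intro power_decreasing) auto
    also have "\<dots> = (\<Prod>i\<in>A. 1/2)" by simp
    also have "\<dots> \<le> (\<Prod>i\<in>A. \<bar>real k - c i\<bar>)"
      using c_half by (intro prod_mono) auto
    finally show ?thesis by (simp add: w_def abs_prod)
  qed
  have w_nz: "w k \<noteq> 0" for k
    using finA c_not_nat by (simp add: w_def)
  have w_upper: "\<bar>w k\<bar> \<le> real d ^ d" if "k \<le> d" for k
  proof -
    have "\<bar>real k - c i\<bar> \<le> real d" if "i \<in> A" for i
    proof -
      \<comment> \<open>An alternation starts at an index that is not the last one, hence is less than \<open>d\<close>.\<close>
      have "ks ! i < d"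
        using that mono_ks[of i "Suc i"] ks_le[of "Suc i"] by (auto simp: A_def)
      then have "real (ks ! i) + 1 \<le> real d" by linarith
      then show ?thesis using \<open>k \<le> d\<close> by (auto simp: c_def)
    qed
    then have "(\<Prod>i\<in>A. \<bar>real k - c i\<bar>) \<le> (\<Prod>i\<in>A. real d)"
      by (intro prod_mono) auto
    also have "\<dots> = real d ^ card A" by simp
    also have "\<dots> \<le> real d ^ d"
      using cardA d by (intro power_increasing) auto
    finally show ?thesis by (simp add: w_def abs_prod)
  qed
  obtain Q where Q: "\<And>k. coeff Q k = w k * coeff P k" and roots: "pos_roots P \<le> pos_roots Q + card A"
    using pos_roots_le_iterated_euler_shift[OF finA P, of c] c_not_nat unfolding w_def by blast

  have same_sign_step: "0 < coeff Q (ks ! n) * coeff Q (ks ! Suc n)" if n: "Suc n < length ks" for n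
  proof -
    \<comment> \<open>Only \<open>c n\<close> separates \<open>ks ! n\<close> from \<open>ks ! Suc n\<close>.\<close>
    have other: "0 < (real (ks ! n) - c i) * (real (ks ! Suc n) - c i)"
      if "i \<in> A - {n}" for i
    proof (cases "i < n")
      case True
      then have "ks ! i < ks ! n" "ks ! n < ks ! Suc n" using mono_ks n by auto
      then have "real (ks ! i) + 1 \<le> real (ks ! n)" "real (ks ! i) + 1 \<le> real (ks ! Suc n)" by linarith+
      then show ?thesis by (intro mult_pos_pos) (auto simp: c_def)
    next
      case False
      then have "n < i" "i < length ks" using that by (auto simp: A_def)
      then have "ks ! Suc n \<le> ks ! i" "ks ! n < ks ! Suc n"
        using mono_ks[of "Suc n" i] mono_ks[of n "Suc n"] n by (cases "i = Suc n"; auto)+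
      then have "real (ks ! n) \<le> real (ks ! i)" "real (ks ! Suc n) \<le> real (ks ! i)" by linarith+
      then show ?thesis by (intro mult_neg_neg) (auto simp: c_def)
    qed
    define r where "r = (\<Prod>i\<in>A - {n}. (real (ks ! n) - c i) * (real (ks ! Suc n) - c i))"
    have r: "0 < r" unfolding r_def using other by (intro prod_pos) auto
    have ww: "w (ks ! n) * w (ks ! Suc n)
        = (\<Prod>i\<in>A. (real (ks ! n) - c i) * (real (ks ! Suc n) - c i))"
      by (simp add: w_def prod.distrib)
    have prodQ: "coeff Q (ks ! n) * coeff Q (ks ! Suc n)
        = (w (ks ! n) * w (ks ! Suc n)) * (coeff P (ks ! n) * coeff P (ks ! Suc n))"
      by (simp add: Q)
    show ?thesis
    proof (cases "n \<in> A")
      case True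
      have "ks ! n < ks ! Suc n" using mono_ks n by auto
      then have "real (ks ! n) + 1 \<le> real (ks ! Suc n)" by linarith
      then have "(real (ks ! n) - c n) * (real (ks ! Suc n) - c n) < 0"
        by (intro mult_neg_pos) (auto simp: c_def)
      then have "w (ks ! n) * w (ks ! Suc n) < 0"
        unfolding ww prod.remove[OF finA True] r_def[symmetric] using r by (rule mult_neg_pos)
      moreover have "coeff P (ks ! n) * coeff P (ks ! Suc n) < 0"
        using True by (simp add: A_def)
      ultimately show ?thesis unfolding prodQ by (rule mult_neg_neg)
    next
      case False
      then have "w (ks ! n) * w (ks ! Suc n) = r"
        unfolding ww r_def by simp
      moreover have "coeff P (ks ! n) \<noteq> 0" "coeff P (ks ! Suc n) \<noteq> 0"
        using T(2) set_ks n by (auto simp: nth_mem)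
      then have "0 < coeff P (ks ! n) * coeff P (ks ! Suc n)"
        using False n by (auto simp: A_def linorder_not_less less_le)
      ultimately show ?thesis unfolding prodQ using r by simp
    qed
  qed
  \<comment> \<open>The common sign of the coefficients of \<open>Q\<close> at tropical indices.\<close>
  define \<sigma> where "\<sigma> = sgn (coeff Q (ks ! 0))"
  have "n < length ks \<Longrightarrow> 0 < \<sigma> * coeff Q (ks ! n)" for n
  proof (induction n)
    case 0
    then have "coeff P (ks ! 0) \<noteq> 0" using T(2) set_ks nth_mem[of 0 ks] by auto
    then have "coeff Q (ks ! 0) \<noteq> 0"
      using w_nz[of "ks ! 0"] by (simp add: Q)
    then show ?case by (auto simp: \<sigma>_def sgn_if)
  next
    case (Suc n)
    then show ?case using same_sign_step[of n]
      by (auto simp: zero_less_mult_iff)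
  qed
  then have same_sign: "0 < \<sigma> * coeff Q k" if "k \<in> T" for k
    using that set_ks by (metis in_set_conv_nth)
  have abs_\<sigma>: "\<bar>\<sigma> * a\<bar> \<le> \<bar>a\<bar>" for a
    by (auto simp: \<sigma>_def sgn_if abs_mult)

  have "poly Q x \<noteq> 0" if x: "0 < x" for x
  proof -
    define t where "t k = \<bar>coeff P k\<bar> * x ^ k" for k
    have "\<exists>m\<le>d. \<forall>k\<le>d. t k \<le> t m"
    proof -
      have "Max (t ` {..d}) \<in> t ` {..d}" by (intro Max_in) auto
      then obtain m where "m \<le> d" "Max (t ` {..d}) = t m" by (metis atMost_iff imageE)
      then show ?thesis by (intro exI[of _ m]) (metis Max_ge atMost_iff finite_atMost finite_imageI imageI)
    qed
    then obtain m where m: "m \<le> d" "\<And>k. k \<le> d \<Longrightarrow> t k \<le> t m" by blast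
    have t0: "0 \<le> t k" for k using x by (simp add: t_def)
    have trop: "k \<in> T" if "k \<le> d" "\<And>i. i \<le> d \<Longrightarrow> t i \<le> exp (Delta d) * t k" for k
      using tropical_index_weighted_polyI[OF deg Delta_nonneg[OF d] pos conc that(1) x] that(2)
      by (auto simp: T_def t_def)
    have one_le: "1 \<le> exp (Delta d)" using Delta_nonneg[OF d] by simp
    have mT: "m \<in> T"
    proof (rule trop[OF m(1)])
      fix i assume "i \<le> d"
      then have "t i \<le> 1 * t m" using m by simp
      also have "\<dots> \<le> exp (Delta d) * t m" using one_le t0 by (intro mult_right_mono) auto
      finally show "t i \<le> exp (Delta d) * t m" .
    qed
    have tm: "0 < t m" using T(2)[OF mT] x by (simp add: t_def)
    define K where "K = real d ^ d * t m / exp (Delta d)"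
    have K: "0 < K" using tm d by (simp add: K_def)
    \<comment> \<open>Since this inequality is strict, the non-strict bound \<open>exp_Delta_ge\<close> suffices.\<close>
    have small: "- K < \<sigma> * coeff Q k * x ^ k" if k: "k \<le> d" for k
    proof (cases "k \<in> T")
      case True
      then have "0 < \<sigma> * coeff Q k * x ^ k" using same_sign x by simp
      then show ?thesis using K by simp
    next
      case False
      then obtain i where i: "i \<le> d" "exp (Delta d) * t k < t i"
        using trop[OF k] by force
      then have "exp (Delta d) * t k < t m" using m(2) by force
      then have less: "t k < t m / exp (Delta d)"
        by (simp add: field_simps)
      have "\<bar>\<sigma> * coeff Q k * x ^ k\<bar> \<le> \<bar>coeff Q k\<bar> * x ^ k"
        using abs_\<sigma>[of "coeff Q k"] x by (simp add: abs_mult mult_right_mono)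
      also have "\<dots> = \<bar>w k\<bar> * t k" by (simp add: Q t_def abs_mult)
      also have "\<dots> \<le> real d ^ d * t k"
        using w_upper[OF k] t0 by (intro mult_right_mono) auto
      also have "\<dots> < real d ^ d * (t m / exp (Delta d))"
        using less d by (intro mult_strict_left_mono) auto
      finally show ?thesis by (simp add: K_def)
    qed
    have large: "(1/2) ^ d * t m \<le> \<sigma> * coeff Q m * x ^ m"
    proof -
      have "\<bar>\<sigma>\<bar> = 1" using same_sign[OF mT] by (auto simp: \<sigma>_def sgn_if split: if_splits)
      have "(1/2) ^ d * t m \<le> \<bar>w m\<bar> * t m"
        using w_lower tm by (intro mult_right_mono) auto
      also have "\<dots> = \<bar>\<sigma> * coeff Q m\<bar> * x ^ m"
        using \<open>\<bar>\<sigma>\<bar> = 1\<close> by (simp add: Q t_def abs_mult)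
      also have "\<bar>\<sigma> * coeff Q m\<bar> = \<sigma> * coeff Q m" using same_sign[OF mT] by simp
      finally show ?thesis .
    qed
    have "degree Q \<le> d"
      by (intro degree_le) (auto simp: Q coeff_eq_0 deg)
    then have "poly Q x = (\<Sum>k\<le>d. coeff Q k * x ^ k)"
      unfolding poly_altdef by (intro sum.mono_neutral_left) (auto simp: coeff_eq_0)
    then have "\<sigma> * poly Q x = (\<Sum>k\<le>d. \<sigma> * coeff Q k * x ^ k)"
      by (simp add: sum_distrib_left mult_ac)
    also have "\<dots> = \<sigma> * coeff Q m * x ^ m + (\<Sum>k\<in>{..d} - {m}. \<sigma> * coeff Q k * x ^ k)"
      using m(1) by (intro sum.remove) auto
    also have "\<dots> > (1/2) ^ d * t m + (\<Sum>k\<in>{..d} - {m}. - K)"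
    proof (intro add_le_less_mono large sum_strict_mono)
      \<comment> \<open>The sum is not empty because \<open>d \<ge> 1\<close>.\<close>
      have "(if m = 0 then 1 else 0) \<in> {..d} - {m}" using d by auto
      then show "{..d} - {m} \<noteq> {}" by blast
    qed (use small in auto)
    also have "(1/2) ^ d * t m + (\<Sum>k\<in>{..d} - {m}. - K) = (1/2) ^ d * t m - real d * K"
      using m(1) by simp
    finally have "(1/2) ^ d * t m - real d * K < \<sigma> * poly Q x" .
    moreover have "real d * K \<le> (1/2) ^ d * t m"
    proof -
      have "real d * real d ^ d * 2 ^ d \<le> exp (Delta d)"
        using exp_Delta_ge[OF d] by (simp add: power_mult_distrib mult_ac)
      then have "real d * real d ^ d / exp (Delta d) \<le> (1/2) ^ d"
        by (simp add: field_simps)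
      from mult_right_mono[OF this less_imp_le[OF tm]] show ?thesis
        by (simp add: K_def)
    qed
    ultimately have "0 < \<sigma> * poly Q x" by linarith
    then show "poly Q x \<noteq> 0" by auto
  qed
  moreover from this[of 1] have "Q \<noteq> 0" by auto
  ultimately have "pos_roots Q = 0"
    by (subst pos_roots_eq_sum_order) (auto intro!: sum.neutral)
  then show ?thesis using roots essential by simp
qed

section \<open>Negative roots\<close>

lemma proots_pcompose_uminus:
  fixes P :: "real poly"
  shows "proots (pcompose P [:0, -1:]) = image_mset uminus (proots P)"
proof (cases "P = 0")
  case False
  have le: "order (- x) R \<le> order x (pcompose R [:0, -1:])" if "R \<noteq> 0" for x and R :: "real poly"
  proof -
    have nz: "pcompose R [:0, -1:] \<noteq> 0" using that by (subst pcompose_eq_0_iff) auto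
    obtain S where S: "R = [:x, 1:] ^ order (- x) R * S"
      using order_1[of "- x" R] by (auto elim: dvdE)
    have pow: "pcompose (U ^ n) V = pcompose U V ^ n" for U V :: "real poly" and n
      by (induction n) (simp_all add: pcompose_1 pcompose_mult)
    have "pcompose R [:0, -1:] = [:x, -1:] ^ order (- x) R * pcompose S [:0, -1:]"
      by (subst S) (simp add: pcompose_mult pow pcompose_pCons)
    also have "[:x, -1:] = - [:- x, 1:]" by simp
    finally have "[:- x, 1:] ^ order (- x) R dvd pcompose R [:0, -1:]"
      by (metis dvd_triv_left dvd_mult2 dvd_power_same minus_dvd_iff dvd_refl)
    then show ?thesis using nz by (simp add: order_divides)
  qed
  have nz: "pcompose P [:0, -1:] \<noteq> 0" using False by (subst pcompose_eq_0_iff) auto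
  have inv: "pcompose (pcompose P [:0, -1:]) [:0, -1:] = P"
    by (simp add: pcompose_assoc[symmetric] pcompose_pCons)
  have "order x (pcompose P [:0, -1:]) = order (- x) P" for x
    using le[OF False, of x] le[OF nz, of "- x"] by (simp add: inv)
  moreover have "count (image_mset uminus M) x = count M (- x)" for M :: "real multiset" and x
    by (induction M) auto
  ultimately show ?thesis
    using False nz by (intro multiset_eqI) simp
qed simp

lemma neg_roots_eq_pos_roots_pcompose:
  "neg_roots P = pos_roots (pcompose P [:0, -1:])"
  by (simp add: neg_roots_def pos_roots_def proots_pcompose_uminus filter_mset_image_mset)

lemma neg_essential_tropical_roots_eq:
  "neg_essential_tropical_roots lam P
    = pos_essential_tropical_roots lam (pcompose P [:0, -1:])"
proof -
  have deg: "degree (weighted_poly lam (pcompose P [:0, -1:])) = degree (weighted_poly lam P)"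
  proof -
    have "weighted_poly lam (pcompose P [:0, -1:]) = pcompose (weighted_poly lam P) [:0, -1:]"
      by (rule poly_eqI) (simp add: coeff_weighted_poly coeff_pcompose_linear)
    then show ?thesis by (simp add: degree_pcompose)
  qed
  have "\<bar>coeff (weighted_poly lam (pcompose P [:0, -1:])) i\<bar> = \<bar>coeff (weighted_poly lam P) i\<bar>" for i
    by (simp add: coeff_weighted_poly coeff_pcompose_linear abs_mult power_abs)
  then have "tropical_indices lam (pcompose P [:0, -1:]) = tropical_indices lam P"
    by (simp add: tropical_indices_def tropical_index_def deg)
  then show ?thesis
    by (simp add: neg_essential_tropical_roots_def pos_essential_tropical_roots_def
        coeff_pcompose_linear)
qed

lemma nonzero_roots_eq: "nonzero_roots P = pos_roots P + neg_roots P"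
proof -
  have "filter_mset (\<lambda>x. x \<noteq> 0) M = filter_mset (\<lambda>x. 0 < x) M + filter_mset (\<lambda>x. x < 0) M"
    for M :: "real multiset"
    by (rule multiset_eqI) auto
  then show ?thesis
    by (simp add: nonzero_roots_def pos_roots_def neg_roots_def)
qed

theorem theorem10:
  fixes d :: nat and lam :: "nat \<Rightarrow> real"
  assumes "d \<ge> 1"
    and "\<forall>k\<le>d. lam k > 0"
    and "\<forall>k\<in>{1..d - 1}. ln ((lam k)\<^sup>2 / (lam (k - 1) * lam (k + 1))) > 2 * Delta d"
  shows "(\<forall>P :: real poly. degree P = d \<longrightarrow>
            pos_roots P \<le> pos_essential_tropical_roots lam P \<and>
            neg_roots P \<le> neg_essential_tropical_roots lam P) \<and>
         real_to_tropical_root_preserver d lam"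
proof -
  have main: "pos_roots P \<le> pos_essential_tropical_roots lam P \<and>
      neg_roots P \<le> neg_essential_tropical_roots lam P" if "degree P = d" for P
  proof -
    have "degree (pcompose P [:0, -1:]) = d" using that by (simp add: degree_pcompose)
    then show ?thesis
      unfolding neg_roots_eq_pos_roots_pcompose neg_essential_tropical_roots_eq
      using pos_roots_le_pos_essential_tropical_roots[OF assms(1) _ assms(2,3)] that by blast
  qed
  moreover have "real_to_tropical_root_preserver d lam"
    unfolding real_to_tropical_root_preserver_def essential_tropical_roots_def nonzero_roots_eq
    using main assms(2) by (auto intro: add_mono)
  ultimately show ?thesis by blast
qed

end
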